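(* Let $\tilde\pi_\Phi$ denote the Carlitz period of $\Phi$. Then $\tilde\pi_\Phi$ can be recovered via the residue $$\operatorname{Res}_{\mathfrak t=\theta}\ \omega_f(\mathfrak t)\,d\frac1{\mathfrak t-\eta}=-\tilde\pi_\Phi .$$
   Context: Let $K=\mathbb F_q(\theta)$, $\iota:\mathbb F_q(t)\to K$, $t\mapsto\theta$. Let $\rho\in\mathbb F_q[t]$ be monic irreducible of degree $N\ge 2$, $\eta$ a root of $\rho$, $\eta^{(i)}=\eta^{q^i}$. Let $\mathcal A$ be the ring of elements of $\mathbb F_q(t)$ regular away from the place $P_\rho$ of $\rho$. Let $K_\rho$ be the completion of $K$ at the place of $\rho(\theta)$, containing $\mathbb F_q(\eta)$ with $\theta-\eta$ a uniformizer, and $\mathbb C_\infty$ the completion of an algebraic closure of $K_\rho$ with $|\theta-\eta|_\eta=q^{-1}$. Let $H=K(\eta)$, $\sigma\in\mathrm{Gal}(H/K)$: $\eta\mapsto\eta^q$; $x^{\sum a_i\sigma^i}=\prod\sigma^i(x)^{a_i}$; $\Theta=\frac1{\theta-\eta}$, so $\Theta^{\sigma^k}=\frac1{\theta-\eta^{(k)}}$. For $g\in\mathbb C_\infty(t)$, $g^{(k)}$ is obtained by raising the coefficients to the $q^k$-th power ($t$ fixed). Let $f(t)=\frac1{t-\eta}-\frac1{\theta-\eta}$, $\mathbf s_0=1$, $\mathbf s_i=f^{(0)}\cdots f^{(i-1)}$, a $\mathbb C_\infty$-basis of $\mathcal A\otimes_{\mathbb F_q}\mathbb C_\infty$. $\Psi:\mathcal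 A\to\mathbb C_\infty\{\tau\}$ is the rank-one Drinfeld module with $\Psi_a=\sum_ic_i\tau^i$ where $a=\sum_ic_i\mathbf s_i$; its coefficients lie in $H$, and $\Psi^{(2)}$ is obtained by applying $\sigma^2$ to them. Let $C_{0,2}=\sqrt[q-1]{\Theta^{\sigma^2-1}}\,\Theta^{\sigma-1}$, where $\sqrt[q-1]{\Theta^{\sigma^2-1}}$ denotes a $(q-1)$-th root of $\Theta^{\sigma^2-1}$, and let $\Phi_a=C_{0,2}^{-1}\circ\Psi^{(2)}_a\circ C_{0,2}$ ($a\in\mathcal A$). The Carlitz period of $\Psi^{(2)}$ is $$\tilde\pi=(-\Theta)^{\frac{\sigma^2}{q-1}}\Theta^\sigma\prod_{k=1}^\infty\frac{\Theta^{q^k}}{\Theta^{q^k}-\Theta^{\sigma^k}},$$ where $(-\Theta)^{\frac{\sigma^2}{q-1}}$ denotes a $(q-1)$-th root of $-\Theta^{\sigma^2}$; it generates the period lattice $\tilde\pi\,\iota(\mathcal A)$ of $\Psi^{(2)}$. The Carlitz period of $\Phi$ is $\tilde\pi_\Phi=\tilde\pi/C_{0,2}$; it generates the lattice $\ker\exp_\Phi$ over $\iota(\mathcal A)$, where $\exp_\Phi$ is the exponential function of $\Phi$. The Anderson–Thakur function is $$\omega_f(\mathfrak t)=(-\Theta)^{\frac1{q-1}}\prod_{k=0}^\infty\frac{\Theta^{q^k}}{\Theta^{q^k}-\frac1{\mathfrak t-\eta^{(k)}}},$$ where $(-\Theta)^{\frac1{q-1}}$ denotes a $(q-1)$-th root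 of $-\Theta$.
   Formalization: The three (q-1)-th roots are required to be compatible: the root of -Θ^{σ^2} is the product of the chosen roots of Θ^{σ^2-1} and -Θ; for independent choices the identity holds only up to a factor in F_q^*. *)

theory Defs
  imports
    "HOL-Analysis.Analysis"
    "HOL-Computational_Algebra.Computational_Algebra"
begin

text \<open>
  Fields with a complete non-archimedean absolute value. The absolute value of \<open>x\<close> is
  \<open>dist x 0\<close>, so that limits, infinite sums and infinite products are those of the library's
  metric topology.
\<close>

class complete_nonarch_field = field + complete_space +
  assumes dist_eq_dist_diff: "dist x y = dist (x - y) 0"
    and dist_mult_zero: "dist (x * y) 0 = dist x 0 * dist y 0"
    and dist_add_zero_le: "dist (x + y) 0 \<le> max (dist x 0) (dist y 0)"

definition is_subfield :: "'a::field set \<Rightarrow> bool" where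
  "is_subfield L \<longleftrightarrow> 0 \<in> L \<and> 1 \<in> L \<and>
     (\<forall>x\<in>L. \<forall>y\<in>L. x - y \<in> L \<and> x * y \<in> L) \<and> (\<forall>x\<in>L. inverse x \<in> L)"

definition field_generated :: "'a::field set \<Rightarrow> 'a set" where
  "field_generated S = \<Inter>{L. is_subfield L \<and> S \<subseteq> L}"

definition algebraic_closure_in :: "'a::field set \<Rightarrow> 'a set" where
  "algebraic_closure_in L = {x. \<exists>p. p \<noteq> 0 \<and> (\<forall>i. coeff p i \<in> L) \<and> poly p x = 0}"

definition algebraically_closed_set :: "'a::field set \<Rightarrow> bool" where
  "algebraically_closed_set L \<longleftrightarrow>
     (\<forall>p. (\<forall>i. coeff p i \<in> L) \<and> degree p > 0 \<longrightarrow> (\<exists>x\<in>L. poly p x = 0))"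

definition field_embedding :: "('k::field \<Rightarrow> 'a::field) \<Rightarrow> bool" where
  "field_embedding e \<longleftrightarrow> e 1 = 1 \<and> (\<forall>x y. e (x + y) = e x + e y \<and> e (x * y) = e x * e y)"

text \<open>
  Throughout, the finite type \<open>'k\<close> is $\mathbb{F}_q$, so \<open>q = CARD('k)\<close>, and
  \<open>e\<close> embeds it into the big field \<open>'a\<close>.
\<close>

definition field_K :: "('k::{field,finite} \<Rightarrow> 'a::field) \<Rightarrow> 'a \<Rightarrow> 'a set" where
  "field_K e \<theta> = field_generated (insert \<theta> (range e))"

definition field_H :: "('k::{field,finite} \<Rightarrow> 'a::field) \<Rightarrow> 'a \<Rightarrow> 'a \<Rightarrow> 'a set" where
  "field_H e \<theta> \<eta> = field_generated (insert \<eta> (field_K e \<theta>))"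

text \<open>
  The type \<open>'a\<close> is $\mathbb{C}_\infty$. Let \<open>\<eta>\<close> be a root of the irreducible polynomial
  \<open>\<rho>\<close> over $\mathbb{F}_q$. As $|\theta-\eta| = q^{-1}$ and nonzero elements algebraic over
  $\mathbb{F}_q$ have absolute value 1, the other factors $\theta-\eta^{(i)}$ of
  $\rho(\theta)$ have absolute value 1. So the absolute value on $K$ is the
  $\rho(\theta)$-adic one, with $|\rho(\theta)| = q^{-1}$, and since \<open>'a\<close> is complete,
  the completion $K_\rho$ is the topological closure of $K$. It contains
  $\eta = \lim_k \theta^{q^{Nk}}$, where $N$ is the degree of \<open>\<rho>\<close>.
  The last two conjuncts say that $K_\rho$ has an algebraic closure inside \<open>'a\<close>, and that
  \<open>'a\<close> is the completion of that algebraic closure.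
\<close>

definition is_C_infty ::
  "('k::{field,finite} \<Rightarrow> 'a::complete_nonarch_field) \<Rightarrow> 'a \<Rightarrow> 'a \<Rightarrow> bool" where
  "is_C_infty e \<theta> \<eta> \<longleftrightarrow>
     field_embedding e \<and>
     (\<forall>p. p \<noteq> 0 \<longrightarrow> poly (map_poly e p) \<theta> \<noteq> 0) \<and>
     dist (\<theta> - \<eta>) 0 = 1 / real CARD('k) \<and>
     algebraically_closed_set (algebraic_closure_in (closure (field_K e \<theta>))) \<and>
     closure (algebraic_closure_in (closure (field_K e \<theta>))) = UNIV"

text \<open>
  The generator \<open>\<sigma>\<close> of $\mathrm{Gal}(H/K)$ is a function on \<open>'a\<close> of which only the
  values on $H$ matter.
\<close>

definition is_frobenius_generator ::
  "('k::{field,finite} \<Rightarrow> 'a::field) \<Rightarrow> 'a \<Rightarrow> 'a \<Rightarrow> ('a \<Rightarrow> 'a) \<Rightarrow> bool" where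
  "is_frobenius_generator e \<theta> \<eta> \<sigma> \<longleftrightarrow>
     bij_betw \<sigma> (field_H e \<theta> \<eta>) (field_H e \<theta> \<eta>) \<and>
     (\<forall>x\<in>field_H e \<theta> \<eta>. \<forall>y\<in>field_H e \<theta> \<eta>.
        \<sigma> (x + y) = \<sigma> x + \<sigma> y \<and> \<sigma> (x * y) = \<sigma> x * \<sigma> y) \<and>
     (\<forall>x\<in>field_K e \<theta>. \<sigma> x = x) \<and>
     \<sigma> \<eta> = \<eta> ^ CARD('k)"

definition Theta :: "'a::field \<Rightarrow> 'a \<Rightarrow> 'a" where
  "Theta \<theta> \<eta> = 1 / (\<theta> - \<eta>)"

text \<open>
  In the following definitions \<open>q\<close> is the cardinality of the constant field, and the argument
  \<open>r\<close> is the chosen \<open>(q - 1)\<close>-th root: of $\Theta^{\sigma^2-1}$ in \<open>C02\<close>, of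
  $-\Theta^{\sigma^2}$ in \<open>carlitz_period_Psi2\<close> and of $-\Theta$ in \<open>omega_f\<close>.
\<close>

definition C02 :: "('a \<Rightarrow> 'a) \<Rightarrow> 'a::field \<Rightarrow> 'a \<Rightarrow> 'a \<Rightarrow> 'a" where
  "C02 \<sigma> \<theta> \<eta> r = r * (\<sigma> (Theta \<theta> \<eta>) / Theta \<theta> \<eta>)"

definition carlitz_period_Psi2 ::
  "nat \<Rightarrow> ('a \<Rightarrow> 'a) \<Rightarrow> 'a::complete_nonarch_field \<Rightarrow> 'a \<Rightarrow> 'a \<Rightarrow> 'a" where
  "carlitz_period_Psi2 q \<sigma> \<theta> \<eta> r =
     r * \<sigma> (Theta \<theta> \<eta>) *
     prodinf (\<lambda>j. let k = Suc j in
       Theta \<theta> \<eta> ^ (q ^ k) / (Theta \<theta> \<eta> ^ (q ^ k) - (\<sigma> ^^ k) (Theta \<theta> \<eta>)))"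

definition carlitz_period_Phi ::
  "nat \<Rightarrow> ('a \<Rightarrow> 'a) \<Rightarrow> 'a::complete_nonarch_field \<Rightarrow> 'a \<Rightarrow> 'a \<Rightarrow> 'a \<Rightarrow> 'a" where
  "carlitz_period_Phi q \<sigma> \<theta> \<eta> r s = carlitz_period_Psi2 q \<sigma> \<theta> \<eta> r / C02 \<sigma> \<theta> \<eta> s"

definition omega_f ::
  "nat \<Rightarrow> 'a::complete_nonarch_field \<Rightarrow> 'a \<Rightarrow> 'a \<Rightarrow> 'a \<Rightarrow> 'a" where
  "omega_f q \<theta> \<eta> r t =
     r * prodinf (\<lambda>k.
       Theta \<theta> \<eta> ^ (q ^ k) / (Theta \<theta> \<eta> ^ (q ^ k) - 1 / (t - \<eta> ^ (q ^ k))))"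

definition has_laurent_series_at ::
  "('a::complete_nonarch_field \<Rightarrow> 'a) \<Rightarrow> 'a fls \<Rightarrow> 'a \<Rightarrow> bool" where
  "has_laurent_series_at g G z \<longleftrightarrow>
     (\<exists>r>0. \<forall>t. 0 < dist t z \<and> dist t z < r \<longrightarrow>
        (\<lambda>n. fls_nth G (fls_subdegree G + int n) * (t - z) powi (fls_subdegree G + int n))
          sums g t)"

text \<open>
  \<open>has_residue_diff g h z c\<close>: the differential \<open>g dh\<close> has residue \<open>c\<close> at
  \<open>z\<close>, that is, \<open>c\<close> is the coefficient of \<open>(t - z)\<^sup>-\<^sup>1 dt\<close> in its Laurent expansion.
\<close>

definition has_residue_diff ::
  "('a::complete_nonarch_field \<Rightarrow> 'a) \<Rightarrow> ('a \<Rightarrow> 'a) \<Rightarrow> 'a \<Rightarrow> 'a \<Rightarrow> bool" where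
  "has_residue_diff g h z c \<longleftrightarrow>
     (\<exists>G H. has_laurent_series_at g G z \<and> has_laurent_series_at h H z \<and>
        fls_residue (G * fls_deriv H) = c)"

end

(*
  Put u = \<theta> - \<eta>, so that \<Theta> = 1/u. As u^(q^k) = \<theta>^(q^k) - \<eta>^(q^k), the k-th factor of
  \<omega>_f(t) is (t - \<eta>^(q^k)) / (t - \<theta>^(q^k)). The factor with k = 0 has a simple pole at \<theta>.
  The others have neither a zero nor a pole in |t - \<theta>| < 1/q, because \<eta> - \<eta>^(q^k) is 0 or has
  absolute value 1. In the weighted norm sup |c_n| q^(-n) on power series in t - \<theta>, the partial
  products of these factors have norm at most 1 and successive differences tending to 0, so
  their product is a power series, with constant term the product in the Carlitz period.
*)
theory Submission
  imports Defs
begin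

section \<open>Ultrametric fields\<close>

lemma dist_minus_zero [simp]:
  fixes x :: "'a::complete_nonarch_field"
  shows "dist (- x) 0 = dist x 0"
  using dist_eq_dist_diff[of 0 x] by (simp add: dist_commute)

lemma ultrametric:
  fixes x :: "'a::complete_nonarch_field"
  shows "dist x z \<le> max (dist x y) (dist y z)"
  using dist_add_zero_le[of "x - y" "y - z"] dist_eq_dist_diff[of x z]
    dist_eq_dist_diff[of x y] dist_eq_dist_diff[of y z] by simp

lemma dist_one_zero [simp]: "dist (1 :: 'a::complete_nonarch_field) 0 = 1"
  using dist_mult_zero[of "1::'a" 1] by simp

lemma dist_power_zero:
  fixes x :: "'a::complete_nonarch_field"
  shows "dist (x ^ n) 0 = dist x 0 ^ n"
  by (induction n) (simp_all add: dist_mult_zero)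

lemma dist_divide_zero:
  fixes x :: "'a::complete_nonarch_field"
  shows "dist (x / y) 0 = dist x 0 / dist y 0"
proof (cases "y = 0")
  case False
  then show ?thesis
    using dist_mult_zero[of "x / y" y] by (simp add: field_simps)
qed simp

text \<open>The isosceles triangle principle: \<open>dist x y\<close> is too small to be the maximum
  in the ultrametric inequality for \<open>dist y 0\<close>, so each of the two lengths bounds the
  other.\<close>

lemma dist_zero_eq_of_dist_less:
  fixes x :: "'a::complete_nonarch_field"
  assumes "dist x y < dist y 0"
  shows "dist x 0 = dist y 0"
  using ultrametric[of x 0 y] ultrametric[of y 0 x] assms by (auto simp: dist_commute)

lemma dist_add_cancel:
  fixes x :: "'a::complete_nonarch_field"
  shows "dist (x + z) (y + z) = dist x y"
  using dist_eq_dist_diff[of "x + z" "y + z"] dist_eq_dist_diff[of x y] by simp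

text \<open>The class itself only supplies a metric; this instance and the one for multiplication
  open up the general rules for limits and series.\<close>

instance complete_nonarch_field \<subseteq> topological_ab_group_add
proof
  fix a b :: 'a
  show "LIM x (nhds a \<times>\<^sub>F nhds b). fst x + snd x :> nhds (a + b)"
  proof (rule tendstoI)
    fix \<epsilon> :: real assume "\<epsilon> > 0"
    then have "\<forall>\<^sub>F x in nhds a \<times>\<^sub>F nhds b. dist (fst x) a < \<epsilon> \<and> dist (snd x) b < \<epsilon>"
      unfolding eventually_prod_filter
      by (intro exI[of _ "\<lambda>x. dist x a < \<epsilon>"] exI[of _ "\<lambda>x. dist x b < \<epsilon>"])
        (auto simp: eventually_nhds_metric)
    then show "\<forall>\<^sub>F x in nhds a \<times>\<^sub>F nhds b. dist (fst x + snd x) (a + b) < \<epsilon>"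
    proof eventually_elim
      case (elim x)
      have "dist (fst x + snd x) (a + b) \<le> max (dist (fst x + snd x) (a + snd x)) (dist (a + snd x) (a + b))"
        by (rule ultrametric)
      also have "\<dots> < \<epsilon>"
        using elim dist_add_cancel[of "snd x" a b] by (simp add: dist_add_cancel add.commute)
      finally show ?case .
    qed
  qed
next
  fix a :: 'a
  have "dist (- x) (- a) = dist x a" for x :: 'a
    using dist_minus_zero[of "x - a"] dist_eq_dist_diff[of "- x" "- a"] dist_eq_dist_diff[of x a] by simp
  then show "(uminus \<longlongrightarrow> - a) (nhds a)"
    by (intro tendstoI) (simp add: eventually_nhds_metric, blast)
qed

lemma tendsto_iff_diff:
  fixes f :: "'b \<Rightarrow> 'a::complete_nonarch_field"
  shows "(f \<longlongrightarrow> l) F \<longleftrightarrow> ((\<lambda>x. dist (f x - l) 0) \<longlongrightarrow> 0) F"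
  by (subst tendsto_dist_iff, subst dist_eq_dist_diff) (rule refl)

instance complete_nonarch_field \<subseteq> topological_semigroup_mult
proof
  fix a b :: 'a
  let ?F = "nhds a \<times>\<^sub>F nhds b"
  have a: "((\<lambda>x. dist (fst x - a) 0) \<longlongrightarrow> 0) ?F" and b: "((\<lambda>x. dist (snd x - b) 0) \<longlongrightarrow> 0) ?F"
    unfolding tendsto_iff_diff[symmetric] by (rule filterlim_fst, rule filterlim_snd)
  have lim: "((\<lambda>x. dist (fst x - a) 0 * dist (snd x - b) 0 + dist (fst x - a) 0 * dist b 0
      + dist a 0 * dist (snd x - b) 0) \<longlongrightarrow> 0 * 0 + 0 * dist b 0 + dist a 0 * 0) ?F"
    by (intro tendsto_intros a b)
  have le: "dist (fst x * snd x - a * b) 0 \<le> dist (fst x - a) 0 * dist (snd x - b) 0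
      + dist (fst x - a) 0 * dist b 0 + dist a 0 * dist (snd x - b) 0" for x :: "'a \<times> 'a"
  proof -
    have "fst x * snd x - a * b = (fst x - a) * (snd x - b) + (fst x - a) * b + a * (snd x - b)"
      by (simp add: algebra_simps)
    then have "dist (fst x * snd x - a * b) 0 \<le> max (max (dist ((fst x - a) * (snd x - b)) 0)
        (dist ((fst x - a) * b) 0)) (dist (a * (snd x - b)) 0)"
      using dist_add_zero_le[of "(fst x - a) * (snd x - b) + (fst x - a) * b" "a * (snd x - b)"]
        dist_add_zero_le[of "(fst x - a) * (snd x - b)" "(fst x - a) * b"] by simp
    also have "\<dots> \<le> dist ((fst x - a) * (snd x - b)) 0 + dist ((fst x - a) * b) 0
        + dist (a * (snd x - b)) 0"
      using zero_le_dist[of "(fst x - a) * (snd x - b)" 0] zero_le_dist[of "(fst x - a) * b" 0]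
        zero_le_dist[of "a * (snd x - b)" 0] by linarith
    finally show ?thesis by (simp add: dist_mult_zero)
  qed
  have "((\<lambda>x. dist (fst x * snd x - a * b) 0) \<longlongrightarrow> 0) ?F"
  proof (rule real_tendsto_sandwich[OF _ _ tendsto_const])
    show "((\<lambda>x. dist (fst x - a) 0 * dist (snd x - b) 0 + dist (fst x - a) 0 * dist b 0
      + dist a 0 * dist (snd x - b) 0) \<longlongrightarrow> 0) ?F"
      using lim by simp
  qed (use le in \<open>simp_all add: always_eventually\<close>)
  then show "LIM x ?F. fst x * snd x :> nhds (a * b)"
    by (subst tendsto_iff_diff)
qed

text \<open>Maxima replace sums in the ultrametric inequality, so the errors of successive steps do
  not accumulate.\<close>

lemma dist_le_of_dist_Suc_le:
  fixes X :: "nat \<Rightarrow> 'a::complete_nonarch_field"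
  assumes "\<And>j. N \<le> j \<Longrightarrow> dist (X (Suc j)) (X j) \<le> \<epsilon>" and "\<epsilon> \<ge> 0" and "N \<le> n"
  shows "dist (X n) (X N) \<le> \<epsilon>"
  using \<open>N \<le> n\<close>
proof (induction n rule: dec_induct)
  case (step n)
  then show ?case
    using ultrametric[of "X (Suc n)" "X N" "X n"] assms(1)[of n] by auto
qed (use assms in simp)

text \<open>As errors do not accumulate, vanishing consecutive differences already make the sequence
  Cauchy, and completeness applies.\<close>

lemma convergent_nonarch:
  fixes X :: "nat \<Rightarrow> 'a::complete_nonarch_field"
  assumes "(\<lambda>n. dist (X (Suc n)) (X n)) \<longlonglongrightarrow> 0"
  shows "convergent X"
proof -
  have "Cauchy X"
    unfolding Cauchy_altdef2
  proof (intro allI impI)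
    fix \<epsilon> :: real assume "\<epsilon> > 0"
    with assms have "\<forall>\<^sub>F n in sequentially. dist (X (Suc n)) (X n) < \<epsilon> / 2"
      by (intro order_tendstoD) auto
    then obtain N where N: "\<And>n. n \<ge> N \<Longrightarrow> dist (X (Suc n)) (X n) < \<epsilon> / 2"
      unfolding eventually_sequentially by blast
    have "dist (X n) (X N) \<le> \<epsilon> / 2" if "n \<ge> N" for n
      by (rule dist_le_of_dist_Suc_le) (use \<open>\<epsilon> > 0\<close> that N in \<open>simp_all add: less_imp_le\<close>)
    moreover have "\<epsilon> / 2 < \<epsilon>" using \<open>\<epsilon> > 0\<close> by simp
    ultimately show "\<exists>N. \<forall>n\<ge>N. dist (X n) (X N) < \<epsilon>"
      using le_less_trans by blast
  qed
  then show ?thesis by (rule Cauchy_convergent)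
qed

lemma summable_nonarch:
  fixes f :: "nat \<Rightarrow> 'a::complete_nonarch_field"
  assumes "(\<lambda>n. dist (f n) 0) \<longlonglongrightarrow> 0"
  shows "summable f"
proof -
  have "dist (\<Sum>i<Suc n. f i) (\<Sum>i<n. f i) = dist (f n) 0" for n
    by (subst dist_eq_dist_diff) simp
  with assms show ?thesis
    unfolding summable_iff_convergent by (intro convergent_nonarch) simp
qed

lemma dist_sums_le:
  fixes f :: "nat \<Rightarrow> 'a::complete_nonarch_field"
  assumes "f sums s" and "\<And>n. dist (f n) 0 \<le> B"
  shows "dist s 0 \<le> B"
proof -
  have "B \<ge> 0" using assms(2)[of 0] zero_le_dist order_trans by blast
  then have "dist (\<Sum>i<n. f i) 0 \<le> B" for n
  proof (induction n)
    case (Suc n)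
    then show ?case
      using dist_add_zero_le[of "\<Sum>i<n. f i" "f n"] assms(2)[of n] by simp
  qed simp
  moreover have "(\<lambda>n. dist (\<Sum>i<n. f i) 0) \<longlonglongrightarrow> dist s 0"
    using assms(1) unfolding sums_def by (intro tendsto_intros)
  ultimately show ?thesis by (intro Lim_bounded) auto
qed

lemma sums_mult_nonarch:
  fixes f :: "nat \<Rightarrow> 'a::complete_nonarch_field"
  assumes "f sums s"
  shows "(\<lambda>n. c * f n) sums (c * s)"
  using tendsto_mult[OF tendsto_const[of c] assms[unfolded sums_def]]
  by (simp add: sums_def sum_distrib_left)


section \<open>Infinite products of Moebius factors as power series\<close>

text \<open>With \<open>x = t - z\<close> and \<open>d = z - c\<close> the factor
  \<open>d + x\<close> is \<open>t - c\<close>, so linear factors can act on expansions about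
  \<open>z\<close>.\<close>

lemma fps_linear_sums:
  fixes F :: "'a::complete_nonarch_field fps"
  assumes "(\<lambda>n. fps_nth F n * x ^ n) sums s"
  shows "(\<lambda>n. fps_nth ((fps_const d + fps_X) * F) n * x ^ n) sums ((d + x) * s)"
proof -
  have "(\<lambda>n. fps_nth (fps_X * F) (Suc n) * x ^ Suc n) sums (x * s)"
    using sums_mult_nonarch[OF assms, of x] by (simp add: mult_ac)
  \<comment> \<open>\<open>sums_Suc\<close> restores the term of index 0, which vanishes for
    \<open>fps_X * F\<close>.\<close>
  then have X: "(\<lambda>n. fps_nth (fps_X * F) n * x ^ n) sums (x * s)"
    using sums_Suc[of "\<lambda>n. fps_nth (fps_X * F) n * x ^ n" "x * s"] by simp
  have "(\<lambda>n. d * (fps_nth F n * x ^ n)) sums (d * s)"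
    by (rule sums_mult_nonarch) (rule assms)
  from sums_add[OF this X] show ?thesis
    by (simp add: ring_distribs mult.assoc)
qed

text \<open>A finite weighted norm leaves a geometric majorant of ratio
  \<open>dist x 0 / \<rho>\<close>, and terms tending to 0 suffice for summability.\<close>

lemma fps_summable_of_bounded:
  fixes F :: "'a::complete_nonarch_field fps"
  assumes bound: "\<And>n. dist (fps_nth F n) 0 * \<rho> ^ n \<le> B" and x: "dist x 0 < \<rho>"
  shows "summable (\<lambda>n. fps_nth F n * x ^ n)"
proof (rule summable_nonarch)
  have "\<rho> > 0" using x zero_le_dist[of x 0] by linarith
  have le: "dist (fps_nth F n * x ^ n) 0 \<le> B * (dist x 0 / \<rho>) ^ n" for n
  proof -
    have "dist (fps_nth F n * x ^ n) 0 = dist (fps_nth F n) 0 * \<rho> ^ n * (dist x 0 / \<rho>) ^ n"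
      using \<open>\<rho> > 0\<close> by (simp add: dist_mult_zero dist_power_zero power_divide)
    also have "\<dots> \<le> B * (dist x 0 / \<rho>) ^ n"
      using \<open>\<rho> > 0\<close> by (intro mult_right_mono bound) simp
    finally show ?thesis .
  qed
  have "(\<lambda>n. (dist x 0 / \<rho>) ^ n) \<longlonglongrightarrow> 0"
    using \<open>\<rho> > 0\<close> x by (intro LIMSEQ_power_zero) simp
  from tendsto_mult_right_zero[OF this] have lim: "(\<lambda>n. B * (dist x 0 / \<rho>) ^ n) \<longlonglongrightarrow> 0" .
  show "(\<lambda>n. dist (fps_nth F n * x ^ n) 0) \<longlonglongrightarrow> 0"
    by (rule real_tendsto_sandwich[OF _ _ tendsto_const lim]) (simp_all add: always_eventually le)
qed

text \<open>The weighted norm dominates every term, hence the value, on the closed disc. Closeness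
  of coefficients thus becomes closeness of values, uniformly in \<open>x\<close>.\<close>

lemma fps_sums_dist_le:
  fixes F :: "'a::complete_nonarch_field fps"
  assumes bound: "\<And>n. dist (fps_nth F n) 0 * \<rho> ^ n \<le> B" and x: "dist x 0 \<le> \<rho>"
    and "(\<lambda>n. fps_nth F n * x ^ n) sums s"
  shows "dist s 0 \<le> B"
proof (rule dist_sums_le)
  show "dist (fps_nth F n * x ^ n) 0 \<le> B" for n
    unfolding dist_mult_zero dist_power_zero
    by (rule order_trans[OF mult_left_mono bound[of n]]) (use x in \<open>auto intro: power_mono\<close>)
qed (rule assms)

text \<open>Comparing coefficients, d times the next coefficient of \<open>G\<close> is the next
  coefficient of \<open>F\<close> minus the current one of \<open>G\<close>. Both have weighted size
  at most \<open>B\<close>, and the absolute value of \<open>d\<close> is at least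
  \<open>\<rho>\<close>, so division costs at most a factor \<open>1 / \<rho>\<close>.\<close>

lemma fps_linear_quotient_bound:
  fixes F G :: "'a::complete_nonarch_field fps"
  assumes eq: "(fps_const d + fps_X) * G = F" and d: "\<rho> \<le> dist d 0" and "\<rho> > 0"
    and bound: "\<And>n. dist (fps_nth F n) 0 * \<rho> ^ n \<le> B"
  shows "dist (fps_nth G n) 0 * \<rho> ^ n \<le> B / \<rho>"
proof -
  have step: "dist (fps_nth G n) 0 * \<rho> ^ n \<le> B / \<rho>"
    if "dist (d * fps_nth G n) 0 * \<rho> ^ n \<le> B" for n
  proof -
    have "dist (fps_nth G n) 0 * \<rho> ^ n * \<rho> \<le> dist (fps_nth G n) 0 * \<rho> ^ n * dist d 0"
      using d \<open>\<rho> > 0\<close> by (intro mult_left_mono) auto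
    also have "\<dots> \<le> B"
      using that by (simp add: dist_mult_zero mult_ac)
    finally show ?thesis
      using \<open>\<rho> > 0\<close> by (simp add: field_simps)
  qed
  show ?thesis
  proof (induction n)
    case 0
    have "fps_nth F 0 = d * fps_nth G 0"
      by (simp flip: eq)
    with bound[of 0] show ?case by (intro step) simp
  next
    case (Suc n)
    have "fps_nth F (Suc n) = d * fps_nth G (Suc n) + fps_nth G n"
      by (simp add: ring_distribs flip: eq)
    then have "d * fps_nth G (Suc n) = fps_nth F (Suc n) + - fps_nth G n"
      by simp
    then have "dist (d * fps_nth G (Suc n)) 0 \<le> max (dist (fps_nth F (Suc n)) 0) (dist (fps_nth G n) 0)"
      using dist_add_zero_le[of "fps_nth F (Suc n)" "- fps_nth G n"] by simp
    moreover have "dist (fps_nth G n) 0 * \<rho> ^ Suc n \<le> B"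
      using Suc \<open>\<rho> > 0\<close> by (simp add: field_simps)
    moreover have "dist (fps_nth F (Suc n)) 0 * \<rho> ^ Suc n \<le> B" by (rule bound)
    moreover have "\<rho> ^ Suc n > 0" using \<open>\<rho> > 0\<close> by simp
    ultimately have "dist (d * fps_nth G (Suc n)) 0 * \<rho> ^ Suc n \<le> B"
      by (auto simp: max_def split: if_splits intro: order_trans[OF mult_right_mono])
    then show ?case by (rule step)
  qed
qed

text \<open>The bound on single steps holds for the whole tail, and a weak inequality survives the
  coefficientwise limit.\<close>

lemma fps_coeff_le_limit:
  fixes P :: "nat \<Rightarrow> 'a::complete_nonarch_field fps"
  assumes "\<And>j n. j \<ge> N \<Longrightarrow> dist (fps_nth (P (Suc j) - P j) n) 0 * \<rho> ^ n \<le> \<epsilon>"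
    and L: "(\<lambda>j. fps_nth (P j) n) \<longlonglongrightarrow> fps_nth L n" and "\<epsilon> \<ge> 0" "\<rho> > 0"
  shows "dist (fps_nth (L - P N) n) 0 * \<rho> ^ n \<le> \<epsilon>"
proof -
  have "dist (fps_nth (P (Suc j)) n) (fps_nth (P j) n) \<le> \<epsilon> / \<rho> ^ n" if "j \<ge> N" for j
    using assms(1)[OF that, of n] \<open>\<rho> > 0\<close>
    by (subst dist_eq_dist_diff) (simp add: field_simps)
  then have "dist (fps_nth (P j) n) (fps_nth (P N) n) \<le> \<epsilon> / \<rho> ^ n" if "j \<ge> N" for j
    using that assms by (rule_tac dist_le_of_dist_Suc_le) auto
  moreover have "(\<lambda>j. dist (fps_nth (P j) n) (fps_nth (P N) n)) \<longlonglongrightarrow> dist (fps_nth L n) (fps_nth (P N) n)"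
    by (intro tendsto_intros L)
  ultimately have "dist (fps_nth L n) (fps_nth (P N) n) \<le> \<epsilon> / \<rho> ^ n"
    by (intro Lim_bounded[of _ _ N]) auto
  then show ?thesis
    using \<open>\<rho> > 0\<close> dist_eq_dist_diff[of "fps_nth L n" "fps_nth (P N) n"] by (simp add: field_simps)
qed

text \<open>Each factor is 1 plus \<open>(a n - b n) / (t - a n)\<close>, and the second summand has
  weighted norm less than 1. One series \<open>F\<close>, chosen before \<open>t\<close>, serves the
  whole disc; \<open>raw_has_prod\<close> also asserts that the value is nonzero.\<close>

lemma raw_has_prod_moebius_power_series:
  fixes a b :: "nat \<Rightarrow> 'a::complete_nonarch_field"
  assumes "\<rho> > 0" and a: "\<And>n. \<rho> \<le> dist z (a n)" and ab: "\<And>n. dist (a n) (b n) < \<rho>"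
    and lim: "(\<lambda>n. dist (a n) (b n)) \<longlonglongrightarrow> 0"
  obtains F where "\<And>t. dist t z < \<rho> \<Longrightarrow> \<exists>p. (\<lambda>n. fps_nth F n * (t - z) ^ n) sums p \<and>
    raw_has_prod (\<lambda>n. (t - b n) / (t - a n)) 0 p"
proof -
  define lin where "lin c = fps_const (z - c) + fps_X" for c
  \<comment> \<open>\<open>P n\<close> expands the partial product in powers of \<open>t - z\<close>: there \<open>t - c\<close> is \<open>z - c + X\<close>.\<close>
  define P where "P n = (\<Prod>i<n. lin (b i) * inverse (lin (a i)))" for n
  \<comment> \<open>A bound for the norm of \<open>P (Suc n) - P n\<close>: the constant
    \<open>a n - b n\<close> contributes its absolute value, division by \<open>lin (a n)\<close> a
    factor \<open>1 / \<rho>\<close>.\<close>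
  define \<epsilon> where "\<epsilon> n = dist (a n) (b n) / \<rho>" for n
  have "lin (a n) * inverse (lin (a n)) = 1" for n
  proof (rule inverse_mult_eq_1')
    show "fps_nth (lin (a n)) 0 \<noteq> 0" using a[of n] \<open>\<rho> > 0\<close> by (auto simp: lin_def)
  qed
  then have P_Suc: "lin (a n) * P (Suc n) = lin (b n) * P n" for n
    by (simp add: P_def algebra_simps)
  have P_diff: "lin (a n) * (P (Suc n) - P n) = fps_const (a n - b n) * P n" for n
  proof -
    have "lin (a n) * (P (Suc n) - P n) = (lin (b n) - lin (a n)) * P n"
      by (simp add: right_diff_distrib left_diff_distrib P_Suc)
    also have "lin (b n) - lin (a n) = fps_const (a n - b n)"
      by (simp add: lin_def flip: fps_const_sub)
    finally show ?thesis .
  qed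
  \<comment> \<open>The bound on \<open>P n\<close> is a premise because the induction for
    \<open>P_bound\<close> uses this estimate to pass from \<open>n\<close> to
    \<open>Suc n\<close>.\<close>
  have diff_bound: "dist (fps_nth (P (Suc n) - P n) m) 0 * \<rho> ^ m \<le> \<epsilon> n"
    if "\<And>m. dist (fps_nth (P n) m) 0 * \<rho> ^ m \<le> 1" for n m
    unfolding \<epsilon>_def
  proof (rule fps_linear_quotient_bound)
    show "(fps_const (z - a n) + fps_X) * (P (Suc n) - P n) = fps_const (a n - b n) * P n"
      using P_diff[of n] by (simp only: lin_def)
    show "\<rho> \<le> dist (z - a n) 0" using a[of n] by (subst dist_eq_dist_diff[symmetric])
    show "dist (fps_nth (fps_const (a n - b n) * P n) m) 0 * \<rho> ^ m \<le> dist (a n) (b n)" for m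
      using mult_left_mono[OF that[of m], of "dist (a n) (b n)"] dist_eq_dist_diff[of "a n" "b n"]
      by (simp add: dist_mult_zero mult.assoc)
  qed (rule \<open>\<rho> > 0\<close>)
  have \<epsilon>_le: "\<epsilon> n \<le> 1" and \<epsilon>_nonneg: "\<epsilon> n \<ge> 0" for n
    using ab[of n] \<open>\<rho> > 0\<close> by (simp_all add: \<epsilon>_def)
  have P_bound: "dist (fps_nth (P n) m) 0 * \<rho> ^ m \<le> 1" for n m
  proof (induction n arbitrary: m)
    case 0
    show ?case by (simp add: P_def)
  next
    case (Suc n)
    have "fps_nth (P (Suc n)) m = fps_nth (P n) m + fps_nth (P (Suc n) - P n) m"
      by simp
    then have "dist (fps_nth (P (Suc n)) m) 0
        \<le> max (dist (fps_nth (P n) m) 0) (dist (fps_nth (P (Suc n) - P n) m) 0)"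
      by (metis dist_add_zero_le)
    then have "dist (fps_nth (P (Suc n)) m) 0 * \<rho> ^ m
        \<le> max (dist (fps_nth (P n) m) 0) (dist (fps_nth (P (Suc n) - P n) m) 0) * \<rho> ^ m"
      using \<open>\<rho> > 0\<close> by (intro mult_right_mono) simp_all
    also have "\<dots> \<le> 1"
      using Suc[of m] order_trans[OF diff_bound[OF Suc, of m] \<epsilon>_le[of n]]
      by (cases "dist (fps_nth (P n) m) 0 \<le> dist (fps_nth (P (Suc n) - P n) m) 0")
        (simp_all only: max_def if_True if_False)
    finally show ?case .
  qed
  have lim_\<epsilon>: "\<epsilon> \<longlonglongrightarrow> 0"
    using tendsto_divide[OF lim tendsto_const[of \<rho>]] \<open>\<rho> > 0\<close> by (simp add: \<epsilon>_def[abs_def])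
  have "convergent (\<lambda>j. fps_nth (P j) m)" for m
  proof (rule convergent_nonarch)
    have le: "dist (fps_nth (P (Suc j)) m) (fps_nth (P j) m) \<le> \<epsilon> j / \<rho> ^ m" for j
      using diff_bound[OF P_bound, of j m] \<open>\<rho> > 0\<close>
      by (subst dist_eq_dist_diff) (simp add: pos_le_divide_eq)
    have "(\<lambda>j. \<epsilon> j / \<rho> ^ m) \<longlonglongrightarrow> 0"
      using tendsto_divide[OF lim_\<epsilon> tendsto_const[of "\<rho> ^ m"]] \<open>\<rho> > 0\<close> by simp
    then show "(\<lambda>j. dist (fps_nth (P (Suc j)) m) (fps_nth (P j) m)) \<longlonglongrightarrow> 0"
      by (rule real_tendsto_sandwich[OF _ _ tendsto_const, rotated 2])
        (simp_all add: always_eventually le)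
  qed
  moreover define L where "L = Abs_fps (\<lambda>m. lim (\<lambda>j. fps_nth (P j) m))"
  ultimately have L: "(\<lambda>j. fps_nth (P j) m) \<longlonglongrightarrow> fps_nth L m" for m
    by (simp add: convergent_LIMSEQ_iff)
  have L_bound: "dist (fps_nth L m) 0 * \<rho> ^ m \<le> 1" for m
  proof (rule Lim_bounded)
    show "(\<lambda>j. dist (fps_nth (P j) m) 0 * \<rho> ^ m) \<longlonglongrightarrow> dist (fps_nth L m) 0 * \<rho> ^ m"
      by (intro tendsto_intros L)
  qed (simp add: P_bound)
  show thesis
  proof (rule that[of L])
    fix t assume t: "dist t z < \<rho>"
    then have x: "dist (t - z) 0 < \<rho>" by (subst dist_eq_dist_diff[symmetric])
    define s where "s n = (\<Prod>i<n. (t - b i) / (t - a i))" for n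
    obtain p where p: "(\<lambda>n. fps_nth L n * (t - z) ^ n) sums p"
      using fps_summable_of_bounded[OF L_bound x] unfolding summable_def by blast
    have ta: "\<rho> \<le> dist (t - a n) 0" for n
      using ultrametric[of z "a n" t] a[of n] t dist_eq_dist_diff[of t "a n"]
      by (simp add: dist_commute)
    then have ta_nz: "t \<noteq> a n" for n
      using \<open>\<rho> > 0\<close> by (metis dist_self linorder_not_le right_minus_eq)
    \<comment> \<open>The inverse series in \<open>P\<close> need not be evaluated: at
      \<open>t\<close> the relation \<open>P_Suc\<close> becomes
      \<open>(t - a n) * s' = (t - b n) * s n\<close>, which is solved for
      \<open>s'\<close>.\<close>
    have sums: "(\<lambda>m. fps_nth (P n) m * (t - z) ^ m) sums s n" for n
    proof (induction n)
      case 0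
      show ?case using sums_finite[of "{0}" "\<lambda>m. fps_nth 1 m * (t - z) ^ m"]
        by (simp add: P_def s_def)
    next
      case (Suc n)
      obtain s' where s': "(\<lambda>m. fps_nth (P (Suc n)) m * (t - z) ^ m) sums s'"
        using fps_summable_of_bounded[OF P_bound x] unfolding summable_def by blast
      have "(z - a n + (t - z)) * s' = (z - b n + (t - z)) * s n"
        using fps_linear_sums[OF s', of "z - a n"] fps_linear_sums[OF Suc, of "z - b n"] P_Suc[of n]
        unfolding lin_def by (metis sums_unique2)
      then have "s' = s (Suc n)"
        using ta_nz[of n] by (simp add: s_def field_simps)
      with s' show ?case by simp
    qed
    \<comment> \<open>Numerator and denominator of each factor differ by less than the size of the
      denominator, so each factor has absolute value 1. The limit inherits this and is
      nonzero.\<close>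
    have "dist (s n) 0 = 1" for n
    proof -
      have "dist ((t - b i) / (t - a i)) 0 = 1" for i
      proof -
        have "dist (t - b i) (t - a i) = dist (a i) (b i)"
          using dist_eq_dist_diff[of "t - b i" "t - a i"] dist_eq_dist_diff[of "a i" "b i"] by simp
        then have "dist (t - b i) 0 = dist (t - a i) 0"
          using ab[of i] ta[of i] by (intro dist_zero_eq_of_dist_less) linarith
        then show ?thesis using ta_nz[of i] by (simp add: dist_divide_zero)
      qed
      then show ?thesis
        unfolding s_def by (induction n) (simp_all add: dist_mult_zero del: times_divide_eq_right)
    qed
    \<comment> \<open>The norm bound on \<open>L - P n\<close> controls all coefficients at once, so
      the values \<open>p\<close> and \<open>s n\<close> are close.\<close>
    moreover have s_lim: "s \<longlonglongrightarrow> p"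
    proof (rule tendstoI)
      fix e :: real assume "e > 0"
      then have "\<forall>\<^sub>F j in sequentially. \<epsilon> j < e / 2"
        using lim_\<epsilon> by (intro order_tendstoD) auto
      then obtain N where N: "\<And>j. j \<ge> N \<Longrightarrow> \<epsilon> j < e / 2"
        unfolding eventually_sequentially by blast
      have "dist (s n) p < e" if "n \<ge> N" for n
      proof -
        have "dist (fps_nth (L - P n) m) 0 * \<rho> ^ m \<le> e / 2" for m
        proof (rule fps_coeff_le_limit)
          show "dist (fps_nth (P (Suc j) - P j) m) 0 * \<rho> ^ m \<le> e / 2" if "n \<le> j" for j m
            using N[of j] \<open>N \<le> n\<close> that diff_bound[OF P_bound, of j m] by linarith
        qed (use L \<open>e > 0\<close> \<open>\<rho> > 0\<close> in auto)
        moreover have "(\<lambda>m. fps_nth (L - P n) m * (t - z) ^ m) sums (p - s n)"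
          using sums_add[OF p sums_mult_nonarch[OF sums[of n], of "-1"]]
          by (simp add: left_diff_distrib)
        ultimately have "dist (p - s n) 0 \<le> e / 2"
          by (rule fps_sums_dist_le[OF _ less_imp_le[OF x]])
        then show ?thesis
          using \<open>e > 0\<close> dist_eq_dist_diff[of p "s n"] by (simp add: dist_commute)
      qed
      then show "\<forall>\<^sub>F n in sequentially. dist (s n) p < e"
        unfolding eventually_sequentially by blast
    qed
    ultimately have "dist p 0 = 1"
      using LIMSEQ_unique[OF tendsto_dist[OF s_lim tendsto_const[of 0]], of 1] by simp
    then have "p \<noteq> 0" by auto
    \<comment> \<open>\<open>raw_has_prod\<close> multiplies over \<open>i \<le> n\<close> while
      \<open>s n\<close> stops below \<open>n\<close>, hence \<open>LIMSEQ_Suc\<close>.\<close>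
    with s_lim have "raw_has_prod (\<lambda>n. (t - b n) / (t - a n)) 0 p"
      unfolding raw_has_prod_def using LIMSEQ_Suc[OF s_lim]
      by (simp add: s_def lessThan_Suc_atMost)
    with p show "\<exists>p. (\<lambda>n. fps_nth L n * (t - z) ^ n) sums p \<and>
      raw_has_prod (\<lambda>n. (t - b n) / (t - a n)) 0 p" by blast
  qed
qed

section \<open>The Frobenius endomorphism\<close>

text \<open>Multiplication by a nonzero \<open>x\<close> permutes the nonzero elements; comparing
  their product before and after gives \<open>x ^ (CARD('k) - 1) = 1\<close>.\<close>

lemma power_card_eq_self:
  fixes x :: "'k::{field,finite}"
  shows "x ^ CARD('k) = x"
proof (cases "x = 0")
  case False
  have "(\<Prod>y\<in>UNIV - {0}. y) = (\<Prod>y\<in>UNIV - {0}. x * y)"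
    by (rule prod.reindex_bij_witness[of _ "\<lambda>y. x * y" "\<lambda>y. y / x"]) (use False in auto)
  also have "\<dots> = x ^ (CARD('k) - 1) * (\<Prod>y\<in>UNIV - {0}. y)"
    by (simp add: prod.distrib card_Diff_singleton)
  finally have "x ^ (CARD('k) - 1) = 1" by simp
  then show ?thesis
    by (metis False power_minus_mult mult_1 finite_UNIV_card_ge_0 finite)
qed (simp add: zero_power)

lemma field_embedding_zero:
  assumes "field_embedding e"
  shows "e 0 = 0"
proof -
  have "e (0 + 0) = e 0 + e 0" using assms unfolding field_embedding_def by blast
  then show ?thesis by (metis add_0_right add_left_cancel)
qed

context
  fixes e :: "'k::field \<Rightarrow> 'a::field"
  assumes e: "field_embedding e"
begin

lemma embedding_simps: "e 0 = 0" "e 1 = 1" "e (x + y) = e x + e y" "e (x * y) = e x * e y"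
  using e field_embedding_zero[OF e] by (simp_all add: field_embedding_def)

lemma poly_map_add: "poly (map_poly e (p + q)) x = poly (map_poly e p) x + poly (map_poly e q) x"
  by (induction p q rule: poly_induct2)
    (simp_all add: map_poly_pCons embedding_simps algebra_simps)

lemma poly_map_mult: "poly (map_poly e (p * q)) x = poly (map_poly e p) x * poly (map_poly e q) x"
  by (induction p)
    (simp_all add: map_poly_pCons map_poly_smult embedding_simps poly_map_add algebra_simps)

lemma poly_map_power: "poly (map_poly e (p ^ n)) x = poly (map_poly e p) x ^ n"
  by (induction n) (simp_all add: poly_map_mult map_poly_1 embedding_simps)

end

lemma frobenius_add:
  fixes e :: "'k::{field,finite} \<Rightarrow> 'a::field" and x y :: 'a
  assumes e: "field_embedding e"
  shows "(x + y) ^ CARD('k) = x ^ CARD('k) + y ^ CARD('k)"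
proof (cases "y = 0")
  case False
  let ?q = "CARD('k)"
  have "?q > 0" by simp
  \<comment> \<open>Both sides are monic of degree \<open>q\<close> and agree at the \<open>q\<close> elements of the finite field.\<close>
  have "([:1, 1:] :: 'k poly) ^ ?q = monom 1 ?q + [:1:]"
  proof (rule poly_eqI_degree_lead_coeff)
    show "coeff (([:1, 1:] :: 'k poly) ^ ?q) ?q = coeff (monom 1 ?q + [:1:]) ?q"
      using lead_coeff_power[of "[:1, 1:] :: 'k poly" ?q] \<open>?q > 0\<close>
      by (simp add: degree_linear_power coeff_pCons split: nat.splits)
    show "degree (monom 1 ?q + [:1:] :: 'k poly) \<le> ?q"
      by (intro degree_add_le) (simp_all add: degree_monom_le)
    show "poly ([:1, 1:] ^ ?q) z = poly (monom 1 ?q + [:1:]) z" if "z \<in> UNIV" for z :: 'k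
      by (simp add: poly_monom power_card_eq_self)
  qed (simp_all add: degree_linear_power)
  then have "poly (map_poly e ([:1, 1:] ^ ?q)) z = poly (map_poly e (monom 1 ?q + [:1:])) z" for z
    by simp
  then have *: "(1 + z) ^ ?q = z ^ ?q + 1" for z :: 'a
    by (simp add: poly_map_power[OF e] poly_map_add[OF e] map_poly_pCons map_poly_monom
        embedding_simps[OF e] poly_monom)
  have "x + y = y * (1 + x / y)"
    using False by (simp add: field_simps)
  then have "(x + y) ^ ?q = y ^ ?q * (1 + x / y) ^ ?q"
    by (simp only: power_mult_distrib)
  also have "\<dots> = x ^ ?q + y ^ ?q"
    using False by (simp add: * power_divide distrib_left)
  finally show ?thesis .
qed (simp add: zero_power)

lemma frobenius_power_diff:
  fixes e :: "'k::{field,finite} \<Rightarrow> 'a::field" and x y :: 'a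
  assumes "field_embedding e"
  shows "(x - y) ^ (CARD('k) ^ n) = x ^ (CARD('k) ^ n) - y ^ (CARD('k) ^ n)"
proof (induction n)
  case (Suc n)
  have "(u - v) ^ CARD('k) = u ^ CARD('k) - v ^ CARD('k)" for u v :: 'a
    using frobenius_add[OF assms, of "u - v" v] by simp
  with Suc show ?case by (simp add: power_mult power_Suc2 del: power_Suc)
qed simp

lemma finite_degree_less: "finite {p :: 'k::{field,finite} poly. degree p < n}"
proof (rule finite_subset)
  show "{p :: 'k poly. degree p < n} \<subseteq> Poly ` {cs. set cs \<subseteq> UNIV \<and> length cs \<le> n}"
  proof
    fix p :: "'k poly" assume "p \<in> {p. degree p < n}"
    then have "length (coeffs p) \<le> n" by (cases "p = 0") (auto simp: length_coeffs)
    then show "p \<in> Poly ` {cs. set cs \<subseteq> UNIV \<and> length cs \<le> n}"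
      by (intro image_eqI[of _ _ "coeffs p"]) simp_all
  qed
  show "finite (Poly ` {cs. set cs \<subseteq> (UNIV :: 'k set) \<and> length cs \<le> n})"
    by (intro finite_imageI finite_lists_length_le) simp
qed

text \<open>Reduction modulo \<open>\<rho>\<close> puts all powers of \<open>\<eta>\<close> among
  finitely many polynomial values, so two Frobenius iterates of \<open>\<eta>\<close>
  coincide.\<close>

lemma algebraic_frobenius_periodic:
  fixes e :: "'k::{field,finite} \<Rightarrow> 'a::field"
  assumes e: "field_embedding e" and "\<rho> \<noteq> 0" and root: "poly (map_poly e \<rho>) \<eta> = 0"
  obtains m where "m > 0" and "\<eta> ^ (CARD('k) ^ m) = \<eta>"
proof -
  let ?q = "CARD('k)"
  let ?S = "(\<lambda>p. poly (map_poly e p) \<eta>) ` {p. degree p < Suc (degree \<rho>)}"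
  have "\<eta> ^ n \<in> ?S" for n
  proof -
    let ?r = "monom 1 n mod \<rho>"
    have "\<eta> ^ n = poly (map_poly e (\<rho> * (monom 1 n div \<rho>) + ?r)) \<eta>"
      by (simp add: map_poly_monom embedding_simps[OF e] poly_monom)
    also have "\<dots> = poly (map_poly e ?r) \<eta>"
      unfolding poly_map_add[OF e] poly_map_mult[OF e] root by simp
    finally have "\<eta> ^ n = poly (map_poly e ?r) \<eta>" .
    moreover have "degree ?r < Suc (degree \<rho>)"
      using degree_mod_less[OF \<open>\<rho> \<noteq> 0\<close>, of "monom 1 n"] by auto
    ultimately show ?thesis by blast
  qed
  then have "range (\<lambda>i. \<eta> ^ (?q ^ i)) \<subseteq> ?S" by blast
  then have "finite (range (\<lambda>i. \<eta> ^ (?q ^ i)))"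
    using finite_degree_less finite_imageI finite_subset by blast
  then have "\<not> inj (\<lambda>i. \<eta> ^ (?q ^ i))"
    using finite_imageD by blast
  then obtain i j where ij: "i < j" "\<eta> ^ (?q ^ i) = \<eta> ^ (?q ^ j)"
    unfolding inj_on_def by (metis linorder_neqE_nat)
  \<comment> \<open>Raising to the power \<open>?q ^ i\<close> respects differences and sends only 0
    to 0, so the first \<open>i\<close> iterations cancel.\<close>
  have "(\<eta> ^ (?q ^ (j - i)) - \<eta>) ^ (?q ^ i) = \<eta> ^ (?q ^ (j - i) * ?q ^ i) - \<eta> ^ (?q ^ i)"
    by (simp add: frobenius_power_diff[OF e] power_mult)
  also have "?q ^ (j - i) * ?q ^ i = ?q ^ j"
    using ij(1) by (simp flip: power_add)
  finally have "\<eta> ^ (?q ^ (j - i)) = \<eta>"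
    using ij(2) by simp
  then show thesis
    using that[of "j - i"] ij(1) by simp
qed

lemma one_less_card_field: "1 < CARD('k::{field,finite})"
  using card_mono[of UNIV "{0, 1 :: 'k}"] by simp

text \<open>Such an \<open>x\<close> is a root of unity, so a positive power of the nonnegative real
  \<open>dist x 0\<close> is 1. This will apply to differences of distinct conjugates of
  \<open>\<eta>\<close>.\<close>

lemma dist_eq_one_of_frobenius_periodic:
  fixes x :: "'a::complete_nonarch_field"
  assumes "x ^ n = x" and "n > 1" and "x \<noteq> 0"
  shows "dist x 0 = 1"
proof -
  have "x ^ (n - 1) * x = x"
    using power_minus_mult[of n x] assms by simp
  then have "x ^ (n - 1) = 1" using \<open>x \<noteq> 0\<close> by simp
  then have "dist x 0 ^ (n - 1) = 1" by (metis dist_power_zero dist_one_zero)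
  then show ?thesis using \<open>n > 1\<close> power_eq_imp_eq_base[of "dist x 0" "n - 1" 1] by simp
qed

section \<open>The conjugates of Theta\<close>

lemma is_subfield_field_generated: "is_subfield (field_generated S)"
  unfolding field_generated_def is_subfield_def by blast

lemma subset_field_generated: "S \<subseteq> field_generated S"
  unfolding field_generated_def by blast

text \<open>Each application of \<open>\<sigma>\<close> fixes \<open>\<theta>\<close> and moves the
  power of \<open>\<eta>\<close> in the denominator to the next one. As \<open>\<sigma>\<close> is
  controlled only on H, membership in H is carried along.\<close>

lemma frobenius_generator_funpow_Theta:
  fixes e :: "'k::{field,finite} \<Rightarrow> 'a::field"
  assumes \<sigma>: "is_frobenius_generator e \<theta> \<eta> \<sigma>" and nz: "\<And>k. \<theta> \<noteq> \<eta> ^ (CARD('k) ^ k)"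
  shows "(\<sigma> ^^ k) (Theta \<theta> \<eta>) = 1 / (\<theta> - \<eta> ^ (CARD('k) ^ k))"
proof -
  let ?q = "CARD('k)" and ?H = "field_H e \<theta> \<eta>" and ?K = "field_K e \<theta>"
  have K: "is_subfield ?K" and "\<theta> \<in> ?K"
    unfolding field_K_def by (use is_subfield_field_generated subset_field_generated in blast)+
  have H: "is_subfield ?H" and "\<eta> \<in> ?H" and "?K \<subseteq> ?H"
    unfolding field_H_def by (use is_subfield_field_generated subset_field_generated in blast)+
  have add: "\<sigma> (x + y) = \<sigma> x + \<sigma> y" and mult: "\<sigma> (x * y) = \<sigma> x * \<sigma> y"
    if "x \<in> ?H" "y \<in> ?H" for x y
    using \<sigma> that unfolding is_frobenius_generator_def by blast+
  have fix_K: "\<sigma> x = x" if "x \<in> ?K" for x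
    using \<sigma> that unfolding is_frobenius_generator_def by blast
  have \<sigma>_\<eta>: "\<sigma> \<eta> = \<eta> ^ ?q"
    using \<sigma> unfolding is_frobenius_generator_def by blast
  have "1 \<in> ?K" using K unfolding is_subfield_def by blast
  have closed: "x - y \<in> ?H" "x * y \<in> ?H" "inverse x \<in> ?H" if "x \<in> ?H" "y \<in> ?H" for x y
    using H that unfolding is_subfield_def by blast+
  have "\<theta> \<in> ?H" "1 \<in> ?H" using \<open>\<theta> \<in> ?K\<close> \<open>1 \<in> ?K\<close> \<open>?K \<subseteq> ?H\<close> by auto
  have pow: "\<eta> ^ n \<in> ?H \<and> \<sigma> (\<eta> ^ n) = (\<eta> ^ ?q) ^ n" for n
  proof (induction n)
    case 0
    show ?case using fix_K[OF \<open>1 \<in> ?K\<close>] \<open>1 \<in> ?H\<close> by simp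
  next
    case (Suc n)
    then show ?case using closed \<open>\<eta> \<in> ?H\<close> mult \<sigma>_\<eta> by simp
  qed
  show ?thesis
  proof (induction k)
    case 0
    show ?case by (simp add: Theta_def)
  next
    case (Suc k)
    let ?y = "\<eta> ^ (?q ^ k)"
    have y: "?y \<in> ?H" "\<sigma> ?y = \<eta> ^ (?q ^ Suc k)"
      using pow[of "?q ^ k"] by (simp_all flip: power_mult)
    have d: "\<theta> - ?y \<in> ?H" using closed y \<open>\<theta> \<in> ?H\<close> by blast
    \<comment> \<open>Additivity is applied to \<open>\<theta> - ?y\<close> and \<open>?y\<close>,
      whose sum is \<open>\<theta>\<close>.\<close>
    have "\<sigma> (\<theta> - ?y) = \<theta> - \<eta> ^ (?q ^ Suc k)"
      using add[OF d y(1)] fix_K[OF \<open>\<theta> \<in> ?K\<close>] y(2)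
      by (simp add: eq_diff_eq)
    moreover have "\<sigma> (1 / (\<theta> - ?y)) * \<sigma> (\<theta> - ?y) = 1"
      using mult[OF closed(3)[OF d d] d] fix_K[OF \<open>1 \<in> ?K\<close>] nz[of k]
      by (simp add: divide_inverse)
    ultimately have "\<sigma> (1 / (\<theta> - ?y)) = 1 / (\<theta> - \<eta> ^ (?q ^ Suc k))"
      using nz[of "Suc k"] by (simp add: eq_divide_eq)
    with Suc show ?case by simp
  qed
qed

section \<open>The residue\<close>

text \<open>Reattaches the factor with k = 0 of \<open>omega_f\<close>, whose pole at
  \<open>\<theta>\<close> keeps it out of the power series.\<close>

lemma has_prod_of_raw_has_prod_Suc:
  fixes f :: "nat \<Rightarrow> 'a::complete_nonarch_field"
  assumes "raw_has_prod (\<lambda>n. f (Suc n)) 0 p" and "f 0 \<noteq> 0"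
  shows "f has_prod (f 0 * p)"
proof -
  have "(\<lambda>n. f 0 * (\<Prod>i\<le>n. f (Suc i))) \<longlonglongrightarrow> f 0 * p" and "p \<noteq> 0"
    using assms unfolding raw_has_prod_def by (auto intro: tendsto_mult)
  then have "(\<lambda>n. \<Prod>i\<le>Suc n. f i) \<longlonglongrightarrow> f 0 * p"
    by (simp only: prod.atMost_Suc_shift)
  then have "(\<lambda>n. \<Prod>i\<le>n. f i) \<longlonglongrightarrow> f 0 * p"
    by (rule LIMSEQ_imp_Suc)
  with \<open>p \<noteq> 0\<close> \<open>f 0 \<noteq> 0\<close> show ?thesis
    unfolding has_prod_def raw_has_prod_def by simp
qed

text \<open>\<open>has_laurent_series_at\<close> starts summing at \<open>fls_subdegree\<close>; the
  nonzero constant term makes this exactly \<open>- int m\<close>, so the sums agree after division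
  by \<open>(t - z) ^ m\<close>.\<close>

lemma has_laurent_series_at_shift_fps:
  fixes F :: "'a::complete_nonarch_field fps"
  assumes "fps_nth F 0 \<noteq> 0" and "\<rho> > 0"
    and sums: "\<And>t. 0 < dist t z \<Longrightarrow> dist t z < \<rho> \<Longrightarrow>
      (\<lambda>n. fps_nth F n * (t - z) ^ n) sums ((t - z) ^ m * g t)"
  shows "has_laurent_series_at g (fls_shift (int m) (fps_to_fls F)) z"
proof -
  let ?G = "fls_shift (int m) (fps_to_fls F)"
  have "fps_to_fls F \<noteq> 0" and "subdegree F = 0"
    using \<open>fps_nth F 0 \<noteq> 0\<close> by auto
  then have deg: "fls_subdegree ?G = - int m"
    by (simp add: fls_shift_subdegree fls_subdegree_fls_to_fps)
  have "(\<lambda>n. fls_nth ?G (fls_subdegree ?G + int n) * (t - z) powi (fls_subdegree ?G + int n)) sums g t"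
    if t: "0 < dist t z" "dist t z < \<rho>" for t
  proof -
    have "t - z \<noteq> 0" using t(1) by auto
    then have "fls_nth ?G (fls_subdegree ?G + int n) * (t - z) powi (fls_subdegree ?G + int n)
        = inverse ((t - z) ^ m) * (fps_nth F n * (t - z) ^ n)" for n
      unfolding deg by (simp add: power_int_diff divide_inverse mult_ac)
    moreover have "inverse ((t - z) ^ m) * ((t - z) ^ m * g t) = g t"
      using \<open>t - z \<noteq> 0\<close> by (simp flip: mult.assoc)
    ultimately show ?thesis
      using sums_mult_nonarch[OF sums[OF t], of "inverse ((t - z) ^ m)"] by presburger
  qed
  with \<open>\<rho> > 0\<close> show ?thesis unfolding has_laurent_series_at_def by blast
qed

text \<open>The quotient bound for the product 1 makes the inverse series converge up to the
  distance from \<open>z\<close> to \<open>c\<close>; its value times \<open>t - c\<close> is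
  1.\<close>

lemma reciprocal_has_laurent_series_at:
  fixes z c :: "'a::complete_nonarch_field"
  assumes "z \<noteq> c"
  shows "has_laurent_series_at (\<lambda>t. 1 / (t - c)) (fps_to_fls (inverse (fps_const (z - c) + fps_X))) z"
proof -
  let ?H = "inverse (fps_const (z - c) + fps_X)"
  have unit: "(fps_const (z - c) + fps_X) * ?H = 1"
    using assms by (intro inverse_mult_eq_1') simp
  have bound: "dist (fps_nth ?H n) 0 * dist (z - c) 0 ^ n \<le> 1 / dist (z - c) 0" for n
    by (rule fps_linear_quotient_bound[OF unit order_refl]) (use assms in auto)
  have "has_laurent_series_at (\<lambda>t. 1 / (t - c)) (fls_shift (int 0) (fps_to_fls ?H)) z"
  proof (rule has_laurent_series_at_shift_fps)
    fix t assume t: "dist t z < dist (z - c) 0"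
    then have "dist (t - z) 0 < dist (z - c) 0" by (subst dist_eq_dist_diff[symmetric])
    from fps_summable_of_bounded[OF bound this]
    obtain s where s: "(\<lambda>n. fps_nth ?H n * (t - z) ^ n) sums s"
      unfolding summable_def by blast
    have "(\<lambda>n. fps_nth 1 n * (t - z) ^ n) sums 1"
      using sums_finite[of "{0}" "\<lambda>n. fps_nth 1 n * (t - z) ^ n"] by simp
    moreover have "(\<lambda>n. fps_nth 1 n * (t - z) ^ n) sums ((z - c + (t - z)) * s)"
      using fps_linear_sums[OF s, of "z - c"] by (simp only: unit)
    ultimately have "(z - c + (t - z)) * s = 1"
      by (rule sums_unique2[symmetric])
    then have "(t - c) * s = 1" by simp
    then have "s = (t - z) ^ 0 * (1 / (t - c))"
      by (cases "t = c") (simp_all add: field_simps)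
    with s show "(\<lambda>n. fps_nth ?H n * (t - z) ^ n) sums ((t - z) ^ 0 * (1 / (t - c)))" by simp
  qed (use assms in auto)
  then show ?thesis by simp
qed

text \<open>Brings the factors of both infinite products into Moebius form, with \<open>c\<close> a
  power of \<open>\<theta> - \<eta>\<close>. For \<open>c = d\<close> both sides are 0 by the
  convention for division by zero.\<close>

lemma inverse_divide_inverse_diff:
  fixes c d :: "'a::field"
  assumes "c \<noteq> 0" and "d \<noteq> 0"
  shows "(1 / c) / (1 / c - 1 / d) = d / (d - c)"
  using assms by (cases "c = d") (simp_all add: field_simps)

text \<open>The three root equations determine
  \<open>r\<^sub>\<pi> / (r\<^sub>C * r\<^sub>\<omega>)\<close> only up to a (q-1)-th root of unity;
  \<open>compatible_roots\<close> makes this ratio 1, so that residue and period agree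
  exactly.\<close>

theorem theorem6:
  fixes e :: "'k::{field,finite} \<Rightarrow> 'a::complete_nonarch_field"
    and \<rho> :: "'k poly"
    and \<theta> \<eta> r\<^sub>\<omega> r\<^sub>\<pi> r\<^sub>C :: 'a
    and \<sigma> :: "'a \<Rightarrow> 'a"
  assumes "is_C_infty e \<theta> \<eta>"
    and "lead_coeff \<rho> = 1" and "irreducible \<rho>" and "degree \<rho> \<ge> 2"
    and "poly (map_poly e \<rho>) \<eta> = 0"
    and "is_frobenius_generator e \<theta> \<eta> \<sigma>"
    and "r\<^sub>\<omega> ^ (CARD('k) - 1) = - Theta \<theta> \<eta>"
    and "r\<^sub>\<pi> ^ (CARD('k) - 1) = - \<sigma> (\<sigma> (Theta \<theta> \<eta>))"
    and "r\<^sub>C ^ (CARD('k) - 1) = \<sigma> (\<sigma> (Theta \<theta> \<eta>)) / Theta \<theta> \<eta>"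
    and compatible_roots: "r\<^sub>\<pi> = r\<^sub>C * r\<^sub>\<omega>"
  shows "has_residue_diff (omega_f CARD('k) \<theta> \<eta> r\<^sub>\<omega>) (\<lambda>t. 1 / (t - \<eta>)) \<theta>
           (- carlitz_period_Phi CARD('k) \<sigma> \<theta> \<eta> r\<^sub>\<pi> r\<^sub>C)"
proof -

  \<comment> \<open>Distances between theta, the zeros and the poles\<close>
  let ?q = "CARD('k)"
  define u where "u = \<theta> - \<eta>"
  \<comment> \<open>Both the absolute value of \<open>u\<close> and the radius of the disc of
    expansion.\<close>
  define \<rho>' where "\<rho>' = 1 / real ?q"
  \<comment> \<open>The indices start at \<open>Suc n\<close>, since the factor with k = 0 has its
    pole at \<open>\<theta>\<close> itself.\<close>
  define a where "a n = \<theta> ^ (?q ^ Suc n)" for n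
  define b where "b n = \<eta> ^ (?q ^ Suc n)" for n
  have e: "field_embedding e" and dist_u: "dist u 0 = \<rho>'"
    using assms(1) unfolding is_C_infty_def u_def \<rho>'_def by blast+
  have q: "?q > 1" by (rule one_less_card_field)
  then have \<rho>': "0 < \<rho>'" "\<rho>' < 1" by (simp_all add: \<rho>'_def)
  then have "u \<noteq> 0" using dist_u by auto
  have frob: "u ^ (?q ^ k) = \<theta> ^ (?q ^ k) - \<eta> ^ (?q ^ k)" for k
    unfolding u_def by (rule frobenius_power_diff[OF e])
  have dist_ab: "dist (a n) (b n) = \<rho>' ^ (?q ^ Suc n)" for n
    unfolding dist_u[symmetric] dist_power_zero[symmetric] frob
    by (simp add: a_def b_def dist_eq_dist_diff[of "_ ^ _" "_ ^ _"])
  \<comment> \<open>Gives both the strict inequality in \<open>ab\<close> and the geometric decay in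
    \<open>lim\<close>.\<close>
  have exponent: "Suc n < ?q ^ Suc n" for n
    using less_exp[of "Suc n"] power_mono[of 2 ?q "Suc n"] q by simp
  have ab: "dist (a n) (b n) < \<rho>'" for n
    unfolding dist_ab using power_strict_decreasing[of 1 "?q ^ Suc n" \<rho>'] \<rho>' exponent[of n] by simp
  have lim: "(\<lambda>n. dist (a n) (b n)) \<longlonglongrightarrow> 0"
  proof (rule real_tendsto_sandwich[OF _ _ tendsto_const])
    show "(\<lambda>n. \<rho>' ^ n) \<longlonglongrightarrow> 0"
      using \<rho>' by (intro LIMSEQ_power_zero) simp
    have "dist (a n) (b n) \<le> \<rho>' ^ n" for n
      unfolding dist_ab using \<rho>' exponent[of n] by (intro power_decreasing) simp_all
    then show "\<forall>\<^sub>F n in sequentially. dist (a n) (b n) \<le> \<rho>' ^ n"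
      by (simp add: always_eventually)
  qed simp
  have "\<rho> \<noteq> 0" using \<open>irreducible \<rho>\<close> by auto
  then obtain m where "m > 0" and m: "\<eta> ^ (?q ^ m) = \<eta>"
    using algebraic_frobenius_periodic[OF e _ assms(5)] by blast
  have "?q ^ m > 1" using q \<open>m > 0\<close> by (rule one_less_power)
  \<comment> \<open>\<open>\<eta> - b n\<close> is fixed by the \<open>m\<close>-fold Frobenius, so
    it is 0 or of absolute value 1. In the first case the distance is that of \<open>u\<close>; in
    the second, \<open>\<theta>\<close> is too close to \<open>\<eta>\<close> to be near
    \<open>b n\<close>.\<close>
  have \<theta>b: "\<rho>' \<le> dist \<theta> (b n)" for n
  proof (cases "\<eta> = b n")
    case True
    then show ?thesis using dist_u dist_eq_dist_diff[of \<theta> "b n"] by (simp add: u_def)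
  next
    case False
    have "b n ^ (?q ^ m) = b n"
      unfolding b_def by (metis m mult.commute power_mult)
    then have "(\<eta> - b n) ^ (?q ^ m) = \<eta> - b n"
      by (simp add: frobenius_power_diff[OF e] m)
    then have "dist (\<eta> - b n) 0 = 1"
      using \<open>?q ^ m > 1\<close> False by (intro dist_eq_one_of_frobenius_periodic) simp_all
    then have "dist \<eta> (b n) = 1" by (subst dist_eq_dist_diff)
    moreover have "dist \<theta> \<eta> = \<rho>'"
      using dist_u unfolding u_def by (subst dist_eq_dist_diff)
    ultimately show ?thesis
      using ultrametric[of \<eta> "b n" \<theta>] \<rho>' by (simp add: dist_commute)
  qed
  \<comment> \<open>Were \<open>a n\<close> closer to \<open>\<theta>\<close> than
    \<open>\<rho>'\<close>, then by \<open>ab\<close> so would be \<open>b n\<close>.\<close>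
  have \<theta>a: "\<rho>' \<le> dist \<theta> (a n)" for n
    using ultrametric[of \<theta> "b n" "a n"] \<theta>b[of n] ab[of n] by simp
  have \<theta>_neq: "\<theta> \<noteq> \<eta> ^ (?q ^ k)" for k
  proof (cases k)
    case 0
    then show ?thesis using \<open>u \<noteq> 0\<close> by (simp add: u_def)
  next
    case (Suc n)
    then show ?thesis using \<theta>b[of n] \<rho>' by (auto simp: b_def)
  qed

  \<comment> \<open>Expansion of the product without its first factor\<close>
  obtain F where F: "\<And>t. dist t \<theta> < \<rho>' \<Longrightarrow>
      \<exists>p. (\<lambda>n. fps_nth F n * (t - \<theta>) ^ n) sums p \<and> raw_has_prod (\<lambda>n. (t - b n) / (t - a n)) 0 p"
    by (rule raw_has_prod_moebius_power_series[OF \<rho>'(1) \<theta>a ab lim], rule that)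
  obtain p where p: "(\<lambda>n. fps_nth F n * (\<theta> - \<theta>) ^ n) sums p"
      "raw_has_prod (\<lambda>n. (\<theta> - b n) / (\<theta> - a n)) 0 p"
    using F[of \<theta>] \<rho>' by auto
  \<comment> \<open>At \<open>t = \<theta>\<close> only the constant term survives, so it equals the
    product in the Carlitz period.\<close>
  have "fps_nth F 0 = p"
    using sums_unique2[OF p(1) sums_finite[of "{0}"]] by simp
  have "p \<noteq> 0" using p(2) by auto
  have Theta: "Theta \<theta> \<eta> = 1 / u" and "Theta \<theta> \<eta> \<noteq> 0"
    using \<open>u \<noteq> 0\<close> by (simp_all add: Theta_def u_def)
  note \<sigma>k = frobenius_generator_funpow_Theta[OF assms(6) \<theta>_neq]
  have \<sigma>_nz: "\<sigma> (Theta \<theta> \<eta>) \<noteq> 0" "\<sigma> (\<sigma> (Theta \<theta> \<eta>)) \<noteq> 0"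
    using \<sigma>k[of 1] \<sigma>k[of 2] \<theta>_neq[of 1] \<theta>_neq[of 2] by (simp_all add: numeral_2_eq_2)
  have "r\<^sub>\<omega> \<noteq> 0" and "r\<^sub>C \<noteq> 0"
    using assms(7,9) \<open>Theta \<theta> \<eta> \<noteq> 0\<close> \<sigma>_nz q by (auto simp: power_0_left)

  \<comment> \<open>The Carlitz period of Phi\<close>
  have period: "carlitz_period_Phi ?q \<sigma> \<theta> \<eta> r\<^sub>\<pi> r\<^sub>C = r\<^sub>\<omega> * p / u"
  proof -
    have "Theta \<theta> \<eta> ^ (?q ^ Suc j) / (Theta \<theta> \<eta> ^ (?q ^ Suc j) - (\<sigma> ^^ Suc j) (Theta \<theta> \<eta>))
        = (\<theta> - b j) / (\<theta> - a j)" for j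
    proof -
      have "Theta \<theta> \<eta> ^ (?q ^ Suc j) / (Theta \<theta> \<eta> ^ (?q ^ Suc j) - (\<sigma> ^^ Suc j) (Theta \<theta> \<eta>))
        = (1 / u ^ (?q ^ Suc j)) / (1 / u ^ (?q ^ Suc j) - 1 / (\<theta> - b j))"
        unfolding \<sigma>k unfolding Theta b_def by (simp only: power_divide power_one)
      also have "\<dots> = (\<theta> - b j) / (\<theta> - b j - u ^ (?q ^ Suc j))"
        using \<theta>_neq[of "Suc j"] \<open>u \<noteq> 0\<close> by (intro inverse_divide_inverse_diff) (simp_all add: b_def)
      also have "\<theta> - b j - u ^ (?q ^ Suc j) = \<theta> - a j"
        unfolding frob a_def b_def by simp
      finally show ?thesis .
    qed
    moreover have "prodinf (\<lambda>j. (\<theta> - b j) / (\<theta> - a j)) = p"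
      using p(2) by (intro has_prod_unique[symmetric]) (simp add: has_prod_def)
    ultimately have "carlitz_period_Psi2 ?q \<sigma> \<theta> \<eta> r\<^sub>\<pi> = r\<^sub>\<pi> * \<sigma> (Theta \<theta> \<eta>) * p"
      unfolding carlitz_period_Psi2_def Let_def by (simp only:)
    \<comment> \<open>The roots reduce to \<open>r\<^sub>\<omega>\<close>, the conjugate of Theta
      cancels against \<open>C02\<close>, and the denominator of \<open>C02\<close> leaves
      \<open>Theta \<theta> \<eta> = 1 / u\<close>.\<close>
    then show ?thesis
      using \<open>r\<^sub>C \<noteq> 0\<close> \<sigma>_nz \<open>u \<noteq> 0\<close>
      by (simp add: carlitz_period_Phi_def C02_def compatible_roots Theta field_simps)
  qed

  \<comment> \<open>The Anderson-Thakur function near theta\<close>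
  have omega: "omega_f ?q \<theta> \<eta> r\<^sub>\<omega> t = r\<^sub>\<omega> * ((t - \<eta>) / (t - \<theta>) * s)"
    if t: "0 < dist t \<theta>" "dist t \<theta> < \<rho>'" and s: "raw_has_prod (\<lambda>n. (t - b n) / (t - a n)) 0 s" for t s
  proof -
    \<comment> \<open>All these powers lie at distance at least \<open>\<rho>'\<close> from
      \<open>\<theta>\<close>, outside the disc, so the Moebius form is valid and the first factor
      is nonzero.\<close>
    have t\<eta>: "t \<noteq> \<eta> ^ (?q ^ k)" for k
    proof (cases k)
      case 0
      have "dist \<theta> \<eta> = \<rho>'" using dist_u unfolding u_def by (subst dist_eq_dist_diff)
      with 0 t show ?thesis by (auto simp: dist_commute)
    next
      case (Suc n)
      then show ?thesis using \<theta>b[of n] t by (auto simp: b_def dist_commute)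
    qed
    define f where "f k = (t - \<eta> ^ (?q ^ k)) / (t - \<theta> ^ (?q ^ k))" for k
    have "Theta \<theta> \<eta> ^ (?q ^ k) / (Theta \<theta> \<eta> ^ (?q ^ k) - 1 / (t - \<eta> ^ (?q ^ k))) = f k" for k
    proof -
      have "Theta \<theta> \<eta> ^ (?q ^ k) / (Theta \<theta> \<eta> ^ (?q ^ k) - 1 / (t - \<eta> ^ (?q ^ k)))
        = (1 / u ^ (?q ^ k)) / (1 / u ^ (?q ^ k) - 1 / (t - \<eta> ^ (?q ^ k)))"
        unfolding Theta by (simp only: power_divide power_one)
      also have "\<dots> = (t - \<eta> ^ (?q ^ k)) / (t - \<eta> ^ (?q ^ k) - u ^ (?q ^ k))"
        using t\<eta>[of k] \<open>u \<noteq> 0\<close> by (intro inverse_divide_inverse_diff) simp_all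
      also have "t - \<eta> ^ (?q ^ k) - u ^ (?q ^ k) = t - \<theta> ^ (?q ^ k)"
        unfolding frob by simp
      finally show ?thesis by (simp only: f_def)
    qed
    moreover have "f has_prod (f 0 * s)"
    proof (rule has_prod_of_raw_has_prod_Suc)
      show "raw_has_prod (\<lambda>n. f (Suc n)) 0 s" using s by (simp add: f_def a_def b_def)
      show "f 0 \<noteq> 0" using t\<eta>[of 0] t(1) by (auto simp: f_def)
    qed
    ultimately show ?thesis
      using has_prod_unique[of f "f 0 * s"] by (simp add: omega_f_def f_def[abs_def])
  qed

  \<comment> \<open>Expands \<open>omega_f\<close> times \<open>t - \<theta>\<close>: the first
    factor leaves \<open>t - \<eta>\<close>, which is \<open>u + (t - \<theta>)\<close>.\<close>
  define G where "G = fps_const r\<^sub>\<omega> * ((fps_const u + fps_X) * F)"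
  have G0: "fps_nth G 0 = r\<^sub>\<omega> * (u * p)"
    by (simp add: G_def \<open>fps_nth F 0 = p\<close>)
  have G: "has_laurent_series_at (omega_f ?q \<theta> \<eta> r\<^sub>\<omega>) (fls_shift (int 1) (fps_to_fls G)) \<theta>"
  proof (rule has_laurent_series_at_shift_fps[OF _ \<rho>'(1)])
    show "fps_nth G 0 \<noteq> 0" using G0 \<open>r\<^sub>\<omega> \<noteq> 0\<close> \<open>u \<noteq> 0\<close> \<open>p \<noteq> 0\<close> by simp
    fix t assume t: "0 < dist t \<theta>" "dist t \<theta> < \<rho>'"
    from F[OF t(2)] obtain s where s: "(\<lambda>n. fps_nth F n * (t - \<theta>) ^ n) sums s"
      "raw_has_prod (\<lambda>n. (t - b n) / (t - a n)) 0 s" by blast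
    have "(t - \<theta>) ^ 1 * omega_f ?q \<theta> \<eta> r\<^sub>\<omega> t = r\<^sub>\<omega> * ((u + (t - \<theta>)) * s)"
      using omega[OF t s(2)] t(1) by (auto simp: u_def)
    then show "(\<lambda>n. fps_nth G n * (t - \<theta>) ^ n) sums ((t - \<theta>) ^ 1 * omega_f ?q \<theta> \<eta> r\<^sub>\<omega> t)"
      using sums_mult_nonarch[OF fps_linear_sums[OF s(1), of u], of r\<^sub>\<omega>]
      by (simp add: G_def mult.assoc)
  qed

  \<comment> \<open>The residue from the leading coefficients\<close>
  define H where "H = inverse (fps_const u + fps_X)"
  have H: "has_laurent_series_at (\<lambda>t. 1 / (t - \<eta>)) (fps_to_fls H) \<theta>"
    unfolding H_def u_def using \<open>u \<noteq> 0\<close> by (intro reciprocal_has_laurent_series_at) (simp add: u_def)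
  have "(fps_const u + fps_X) * H = 1"
    unfolding H_def using \<open>u \<noteq> 0\<close> by (intro inverse_mult_eq_1') simp
  then have "fps_nth ((fps_const u + fps_X) * H) 0 = 1" "fps_nth ((fps_const u + fps_X) * H) 1 = 0"
    by simp_all
  then have "u * fps_nth H 0 = 1" "u * fps_nth H 1 + fps_nth H 0 = 0"
    by (simp_all add: ring_distribs)
  then have "fps_nth H 0 = 1 / u" "u * fps_nth H 1 = - fps_nth H 0"
    using \<open>u \<noteq> 0\<close> by (simp_all add: eq_divide_eq eq_neg_iff_add_eq_0 mult.commute)
  then have H1: "fps_nth H 1 = - 1 / (u * u)"
    using \<open>u \<noteq> 0\<close> by (simp add: field_simps)
  \<comment> \<open>The pole is simple, so only the leading coefficient
    \<open>r\<^sub>\<omega> * (u * p)\<close> meets the constant term \<open>- 1 / (u * u)\<close>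
    of the derivative of \<open>H\<close>.\<close>
  have "fls_residue (fls_shift (int 1) (fps_to_fls G) * fls_deriv (fps_to_fls H))
      = fps_nth (G * fps_deriv H) 0"
    by (simp add: fls_deriv_fps_to_fls fls_shifted_times_simps flip: fls_times_fps_to_fls)
  also have "\<dots> = - (r\<^sub>\<omega> * p / u)"
    using H1 \<open>u \<noteq> 0\<close> by (simp add: G0)
  finally show ?thesis
    using G H unfolding has_residue_diff_def period by blast
qed

end
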